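(* Let $(S_n)_{n\ge 0}$ be a random walk in $\mathbb{Z}^3$ or $\mathbb{R}^3$ which is truly three-dimensional and whose three components $(S_n^1)_n$, $(S_n^2)_n$, $(S_n^3)_n$ are independent of each other. Then $(S_n)$ is polygonally transient.
   Context: A random walk is $S_n=X_1+\dots+X_n$, $S_0=0$, with i.i.d. increments $X_j$. It is truly three-dimensional if the law of $X_1$ is not supported by a proper linear subspace of $\mathbb{R}^3$. A random walk $(S_n)$ in $\mathbb{Z}^d$ or $\mathbb{R}^d$ is called polygonally recurrent if there is a bounded set $B$ such that almost surely there are infinitely many $n$ for which the straight line segment between $S_n$ and $S_{n+1}$ hits $B$; it is called polygonally transient if there is no bounded set $B$ with this property. *)

theory Defs
  imports "HOL-Probability.Probability"
begin

text \<open>Steps are indexed from 0: the step from \<open>S\<^sub>n\<close> to \<open>S\<^sub>n\<^sub>+\<^sub>1\<close> is \<open>X n\<close>, so \<open>X 0\<close> has the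
  step law. Walks in the integer lattice are the walks in Euclidean space whose steps are
  lattice-valued.\<close>

definition iid_steps :: "'a measure \<Rightarrow> (nat \<Rightarrow> 'a \<Rightarrow> 'b::euclidean_space) \<Rightarrow> bool" where
  "iid_steps M X \<longleftrightarrow>
     prob_space.indep_vars M (\<lambda>_. borel) X UNIV \<and>
     (\<forall>n. distr M borel (X n) = distr M borel (X 0))"

definition walk :: "(nat \<Rightarrow> 'a \<Rightarrow> 'b::euclidean_space) \<Rightarrow> nat \<Rightarrow> 'a \<Rightarrow> 'b" where
  "walk X n \<omega> = (\<Sum>j<n. X j \<omega>)"

definition truly_full_dimensional :: "'b::euclidean_space measure \<Rightarrow> bool" where
  "truly_full_dimensional \<mu> \<longleftrightarrow>
     \<not> (\<exists>V. subspace V \<and> V \<noteq> UNIV \<and> (AE x in \<mu>. x \<in> V))"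

text \<open>Independence of the coordinate processes as random elements of the sequence space,
  not merely independence of the coordinates at each fixed time.\<close>

definition independent_components ::
    "'a measure \<Rightarrow> (nat \<Rightarrow> 'a \<Rightarrow> real ^ 'd) \<Rightarrow> bool" where
  "independent_components M S \<longleftrightarrow>
     prob_space.indep_vars M (\<lambda>_. Pi\<^sub>M UNIV (\<lambda>_. borel)) (\<lambda>i \<omega> n. S n \<omega> $ i) UNIV"

definition polygonally_recurrent ::
    "'a measure \<Rightarrow> (nat \<Rightarrow> 'a \<Rightarrow> 'b::euclidean_space) \<Rightarrow> bool" where
  "polygonally_recurrent M S \<longleftrightarrow>
     (\<exists>B. bounded B \<and>
        (AE \<omega> in M. \<exists>\<^sub>\<infinity>n. closed_segment (S n \<omega>) (S (Suc n) \<omega>) \<inter> B \<noteq> {}))"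

definition polygonally_transient ::
    "'a measure \<Rightarrow> (nat \<Rightarrow> 'a \<Rightarrow> 'b::euclidean_space) \<Rightarrow> bool" where
  "polygonally_transient M S \<longleftrightarrow> \<not> polygonally_recurrent M S"

end

theory Submission
  imports Defs
begin

text \<open>Write \<open>S\<^sub>n\<close> for the walk, \<open>X\<^sub>n\<close> for its steps and let \<open>B\<close> lie in the ball of radius \<open>R\<close>. If the segment from
  \<open>S\<^sub>n\<close> to \<open>S\<^sub>n\<^sub>+\<^sub>1\<close> hits \<open>B\<close>, then in each coordinate \<open>i\<close> one has \<open>\<bar>S\<^sub>n\<^sup>i\<bar> \<le> \<bar>X\<^sub>n\<^sup>i\<bar> + R\<close>. The heart of the proof is
  the one-dimensional estimate \<open>P(\<bar>S\<^sub>n\<bar> \<le> \<bar>X\<^sub>n\<bar> + R) \<le> C / sqrt n\<close>, valid for every real random walk whose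
  steps are not almost surely 0, without any moment assumption (\<open>ex_crossing_bound\<close>). By independence
  of the three coordinates the \<open>n\<close>-th segment hits \<open>B\<close> with probability of order at most \<open>n powr (- 3 / 2)\<close>,
  and the Borel--Cantelli lemma finishes the proof. True three-dimensionality is used in the form that no
  coordinate of the step vanishes almost surely.

  The one-dimensional estimate is plain if the steps are a nonzero constant. Otherwise, condition on the step \<open>X\<^sub>n = x\<close>, which is independent of \<open>S\<^sub>n\<close>. A concentration
  inequality of Kolmogorov--Rogozin type (\<open>measure_char_power_le\<close>) gives
  \<open>P(\<bar>S\<^sub>n\<bar> \<le> k l) \<le> C(k) / sqrt (n p)\<close>, where \<open>p\<close> is the probability that two independent steps differ by at
  least \<open>l\<close>. For large \<open>\<bar>x\<bar>\<close> and \<open>l\<close> slightly smaller than \<open>\<bar>x\<bar>\<close>, this \<open>p\<close> is at least half of \<open>q(x) = P(\<bar>X\<bar> \<ge> \<bar>x\<bar>)\<close>, whence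
  \<open>P(\<bar>S\<^sub>n\<bar> \<le> \<bar>x\<bar> + R) \<le> C / sqrt (n q(x))\<close> (\<open>ex_concentration_bound\<close>). Finally
  \<open>P(q(X) \<le> u) \<le> u\<close>, so \<open>1 / sqrt q(X)\<close> is integrable (\<open>integrable_inverse_sqrt_abs_tail\<close>): a large step makes
  hitting easy, but is rare to the right extent.

  The concentration inequality is proved with characteristic functions. For \<open>Z\<close> standard normal,
  \<open>E exp (- (T S\<^sub>n)\<^sup>2 / 2)\<close> is the expectation of the characteristic function of \<open>S\<^sub>n\<close> at \<open>T Z\<close>. The
  latter is an \<open>n\<close>-th power, bounded by \<open>exp (- n E sin\<^sup>2 (t (X - X') / 2))\<close> at \<open>t\<close>, where \<open>X'\<close> is an
  independent copy of \<open>X\<close>. Jensen's inequality on the event \<open>\<bar>X - X'\<bar> \<ge> l\<close> reduces matters to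
  \<open>E exp (- a sin\<^sup>2 (y Z / 2)) \<le> 10 / sqrt a\<close> for \<open>\<bar>y\<bar> \<ge> 1\<close> (\<open>integral_exp_sin_le\<close>), which follows by expanding
  even powers of the cosine into exponentials.\<close>

section \<open>Gaussian averages of trigonometric functions\<close>

text \<open>With \<open>Z\<close> standard normal, \<open>E exp (i t Z) = exp (- t\<^sup>2 / 2)\<close>. Averaging this over \<open>t = T x\<close> and
  exchanging the two integrals expresses a Gaussian average of \<open>\<nu>\<close> by its characteristic function.\<close>

lemma integral_gauss_eq_integral_char:
  assumes "real_distribution \<nu>"
  shows "complex_of_real (\<integral>x. exp (- (T * x)\<^sup>2 / 2) \<partial>\<nu>) = (\<integral>z. char \<nu> (T * z) \<partial>std_normal_distribution)"
proof -
  interpret \<nu>: real_distribution \<nu> by fact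
  interpret G: real_distribution std_normal_distribution by (rule real_dist_normal_dist)
  interpret P: pair_prob_space std_normal_distribution \<nu> ..
  have int: "integrable (std_normal_distribution \<Otimes>\<^sub>M \<nu>) (\<lambda>(z, x). iexp (T * z * x))"
    by (rule P.integrable_const_bound[where B=1]) (auto simp: split_beta simp del: of_real_mult)
  have "complex_of_real (\<integral>x. exp (- (T * x)\<^sup>2 / 2) \<partial>\<nu>) = (\<integral>x. char std_normal_distribution (T * x) \<partial>\<nu>)"
    by (simp add: char_std_normal_distribution integral_complex_of_real)
  also have "\<dots> = (\<integral>x. (\<integral>z. iexp (T * z * x) \<partial>std_normal_distribution) \<partial>\<nu>)"
    unfolding char_def by (simp add: mult_ac)
  also have "\<dots> = (\<integral>z. char \<nu> (T * z) \<partial>std_normal_distribution)"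
    unfolding char_def by (rule P.Fubini_integral[OF int])
  finally show ?thesis .
qed

lemma integral_gauss_le_integral_cmod_char:
  assumes "real_distribution \<nu>"
  shows "(\<integral>x. exp (- (T * x)\<^sup>2 / 2) \<partial>\<nu>) \<le> (\<integral>z. cmod (char \<nu> (T * z)) \<partial>std_normal_distribution)"
proof -
  have "(\<integral>x. exp (- (T * x)\<^sup>2 / 2) \<partial>\<nu>) \<le> cmod (\<integral>z. char \<nu> (T * z) \<partial>std_normal_distribution)"
    unfolding integral_gauss_eq_integral_char[OF assms, symmetric] by simp
  also have "\<dots> \<le> (\<integral>z. cmod (char \<nu> (T * z)) \<partial>std_normal_distribution)"
    by (rule integral_norm_bound)
  finally show ?thesis .
qed

lemma central_binomial_le:
  "real ((2 * k) choose k) / 4 ^ k \<le> 1 / sqrt (2 * real k + 1)"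
proof -
  define c where "c k = real ((2 * k) choose k) / 4 ^ k" for k
  have c_Suc: "c (Suc k) * (2 * real k + 2) = c k * (2 * real k + 1)" for k
  proof -
    have "(2 * Suc k) choose Suc k = 2 * ((2 * k + 1) choose k)"
      using binomial_symmetric[of k "2 * k + 1"] by simp
    moreover have "Suc k * ((2 * k + 1) choose k) = (2 * k + 1) * ((2 * k) choose k)"
      using binomial_absorb_comp[of "2 * k + 1" k] by simp
    ultimately have "real (Suc k) * real ((2 * Suc k) choose Suc k) = 2 * ((2 * real k + 1) * real ((2 * k) choose k))"
      by (metis (no_types, opaque_lifting) mult.left_commute of_nat_1 of_nat_add of_nat_mult of_nat_numeral)
    then have "real ((2 * Suc k) choose Suc k) * (2 * real k + 2) = 4 * (real ((2 * k) choose k) * (2 * real k + 1))"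
      by (simp only: of_nat_Suc) (simp only: algebra_simps)
    then have "real ((2 * Suc k) choose Suc k) / (4 * 4 ^ k) * (2 * real k + 2) =
        4 * (real ((2 * k) choose k) * (2 * real k + 1)) / (4 * 4 ^ k)"
      by (simp only: times_divide_eq_left)
    then show ?thesis
      unfolding c_def power_Suc by simp
  qed
  have "(c k)\<^sup>2 * (2 * real k + 1) \<le> 1"
  proof (induction k)
    case 0
    then show ?case by (simp add: c_def)
  next
    case (Suc k)
    have eq: "2 * real (Suc k) + 1 = 2 * real k + 3" by simp
    have "(c (Suc k))\<^sup>2 * (2 * real (Suc k) + 1) * (2 * real k + 2)\<^sup>2
        = (c (Suc k) * (2 * real k + 2))\<^sup>2 * (2 * real k + 3)"
      unfolding eq power_mult_distrib by (simp only: mult_ac)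
    also have "\<dots> = (c k)\<^sup>2 * (2 * real k + 1) * ((2 * real k + 1) * (2 * real k + 3))"
      unfolding c_Suc by (simp add: power_mult_distrib power2_eq_square)
    also have "\<dots> \<le> 1 * (2 * real k + 2)\<^sup>2"
      by (intro mult_mono Suc.IH) (auto simp: power2_eq_square algebra_simps)
    finally show ?case
      by (simp add: mult_le_cancel_right)
  qed
  then have "(c k)\<^sup>2 \<le> (1 / sqrt (2 * real k + 1))\<^sup>2"
    by (simp add: power_divide field_simps)
  then have "c k \<le> 1 / sqrt (2 * real k + 1)"
    by (rule power2_le_imp_le) simp
  then show ?thesis
    by (simp add: c_def)
qed

text \<open>The binomial expansion of \<open>((exp (i u / 2) + exp (- i u / 2)) / 2) ^ (2 k)\<close>.\<close>

lemma cos_even_power: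
  "complex_of_real (cos (u / 2) ^ (2 * k)) =
     (\<Sum>i\<le>2*k. of_real (real ((2 * k) choose i) / 4 ^ k) * iexp ((real i - real k) * u))"
proof -
  have "2 * cos (complex_of_real (u / 2)) = iexp (u / 2) + iexp (- u / 2)"
    by (simp add: cos_exp_eq)
  then have "(2 * complex_of_real (cos (u / 2))) ^ (2 * k) = (iexp (u / 2) + iexp (- u / 2)) ^ (2 * k)"
    by (simp only: cos_of_real)
  also have "\<dots> = (\<Sum>i\<le>2*k. of_nat ((2 * k) choose i) * iexp (u / 2) ^ i * iexp (- u / 2) ^ (2 * k - i))"
    by (rule binomial_ring)
  also have "\<dots> = (\<Sum>i\<le>2*k. of_nat ((2 * k) choose i) * iexp ((real i - real k) * u))"
  proof (intro sum.cong refl)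
    fix i assume "i \<in> {..2 * k}"
    then have "iexp (u / 2) ^ i * iexp (- u / 2) ^ (2 * k - i) = iexp ((real i - real k) * u)"
      by (simp add: exp_of_nat_mult[symmetric] exp_add[symmetric] of_nat_diff field_simps
          del: of_real_mult of_real_minus of_real_divide)
         (rule arg_cong[where f=exp], simp add: field_simps)
    then show "of_nat ((2 * k) choose i) * iexp (u / 2) ^ i * iexp (- u / 2) ^ (2 * k - i) =
        of_nat ((2 * k) choose i) * iexp ((real i - real k) * u)"
      by (simp add: mult.assoc)
  qed
  finally have "4 ^ k * complex_of_real (cos (u / 2)) ^ (2 * k) =
      (\<Sum>i\<le>2*k. of_nat ((2 * k) choose i) * iexp ((real i - real k) * u))"
    by (simp only: power_mult_distrib power_mult[of "2::complex"]) simp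
  then have "complex_of_real (cos (u / 2)) ^ (2 * k) =
      (\<Sum>i\<le>2*k. of_nat ((2 * k) choose i) * iexp ((real i - real k) * u)) / 4 ^ k"
    by (simp add: nonzero_eq_divide_eq mult.commute del: of_real_mult of_real_diff)
  then show ?thesis
    by (simp add: sum_divide_distrib del: of_real_mult of_real_diff)
qed

text \<open>Since \<open>d\<^sup>2 \<ge> \<bar>d\<bar>\<close> for integers \<open>d\<close>, the sum is dominated by two geometric series with ratio
  \<open>exp (- 1 / 2) \<le> 2 / 3\<close>.\<close>

lemma sum_gauss_le:
  fixes y :: real
  assumes "\<bar>y\<bar> \<ge> 1"
  shows "(\<Sum>i\<le>2*k. exp (- ((real i - real k) * y)\<^sup>2 / 2)) \<le> 6"
proof -
  define r :: real where "r = exp (- 1 / 2)"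
  have "1 + 1 / 2 \<le> exp (1 / 2 :: real)" by (rule exp_ge_add_one_self)
  then have r: "0 < r" "r \<le> 2 / 3" by (auto simp: r_def exp_minus field_simps)
  have geo: "(\<Sum>j\<le>k. r ^ j) \<le> 3"
  proof -
    have "(\<Sum>j\<le>k. r ^ j) = (1 - r ^ Suc k) / (1 - r)"
      using r by (subst sum_gp0) auto
    also have "\<dots> \<le> 1 / (1 / 3)"
      using r by (intro frac_le) auto
    finally show ?thesis by simp
  qed
  have le: "exp (- ((real i - real k) * y)\<^sup>2 / 2) \<le> r ^ nat \<bar>int i - int k\<bar>" for i
  proof -
    define d where "d = nat \<bar>int i - int k\<bar>"
    have d: "real d = \<bar>real i - real k\<bar>" unfolding d_def by linarith
    have "real d \<le> (real d)\<^sup>2"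
      by (cases "d = 0") (auto simp: power2_eq_square)
    also have "\<dots> * 1 \<le> (real d)\<^sup>2 * y\<^sup>2"
      using assms by (intro mult_left_mono) (auto simp: abs_le_square_iff[of 1 y, simplified])
    also have "\<dots> = ((real i - real k) * y)\<^sup>2"
      by (simp add: d power_mult_distrib)
    finally show ?thesis
      by (simp add: r_def exp_of_nat_mult[symmetric] d_def[symmetric])
  qed
  have "(\<Sum>i\<le>2*k. exp (- ((real i - real k) * y)\<^sup>2 / 2)) \<le> (\<Sum>i\<in>{..k} \<union> {k..2*k}. r ^ nat \<bar>int i - int k\<bar>)"
    using r by (intro order_trans[OF sum_mono[OF le] sum_mono2]) auto
  also have "\<dots> \<le> (\<Sum>i\<le>k. r ^ nat \<bar>int i - int k\<bar>) + (\<Sum>i=k..2*k. r ^ nat \<bar>int i - int k\<bar>)"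
    using r by (subst sum.union_inter[symmetric]) (auto intro!: sum_nonneg)
  also have "(\<Sum>i\<le>k. r ^ nat \<bar>int i - int k\<bar>) = (\<Sum>j\<le>k. r ^ j)"
    by (rule sum.reindex_bij_witness[of _ "\<lambda>j. k - j" "\<lambda>j. k - j"]) (auto intro!: arg_cong[where f="\<lambda>n. r ^ n"])
  also have "(\<Sum>i=k..2*k. r ^ nat \<bar>int i - int k\<bar>) = (\<Sum>j\<le>k. r ^ j)"
    by (rule sum.reindex_bij_witness[of _ "\<lambda>j. k + j" "\<lambda>j. j - k"]) (auto intro!: arg_cong[where f="\<lambda>n. r ^ n"])
  finally show ?thesis using geo by linarith
qed

text \<open>Each frequency \<open>(i - k) y\<close> of \<open>cos (y z / 2) ^ (2 k)\<close> contributes a Gaussian factor, so the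
  expectation is at most a constant times the central (largest) binomial weight.\<close>

lemma integral_cos_even_power_le:
  fixes y :: real
  assumes "\<bar>y\<bar> \<ge> 1"
  shows "(\<integral>z. cos (y * z / 2) ^ (2 * k) \<partial>std_normal_distribution) \<le> 6 / sqrt (2 * real k + 1)"
proof -
  interpret G: real_distribution std_normal_distribution by (rule real_dist_normal_dist)
  have int: "integrable std_normal_distribution (\<lambda>z. iexp (t * z))" for t
    by (rule G.integrable_const_bound[where B=1]) (auto simp del: of_real_mult)
  have "complex_of_real (\<integral>z. cos (y * z / 2) ^ (2 * k) \<partial>std_normal_distribution) =
      (\<integral>z. (\<Sum>i\<le>2*k. of_real (real ((2 * k) choose i) / 4 ^ k) * iexp ((real i - real k) * y * z)) \<partial>std_normal_distribution)"
    unfolding integral_complex_of_real[symmetric] cos_even_power by (simp add: mult_ac)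
  also have "\<dots> = (\<Sum>i\<le>2*k. of_real (real ((2 * k) choose i) / 4 ^ k) * char std_normal_distribution ((real i - real k) * y))"
    unfolding char_def
    by (subst Bochner_Integration.integral_sum) (auto intro!: int integrable_mult_right simp del: of_real_mult of_real_divide)
  also have "\<dots> = of_real (\<Sum>i\<le>2*k. real ((2 * k) choose i) / 4 ^ k * exp (- ((real i - real k) * y)\<^sup>2 / 2))"
    by (simp add: char_std_normal_distribution)
  finally have "(\<integral>z. cos (y * z / 2) ^ (2 * k) \<partial>std_normal_distribution) =
      (\<Sum>i\<le>2*k. real ((2 * k) choose i) / 4 ^ k * exp (- ((real i - real k) * y)\<^sup>2 / 2))"
    by (simp only: of_real_eq_iff)
  also have "\<dots> \<le> (\<Sum>i\<le>2*k. 1 / sqrt (2 * real k + 1) * exp (- ((real i - real k) * y)\<^sup>2 / 2))"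
  proof (intro sum_mono mult_right_mono)
    fix i
    have "real ((2 * k) choose i) / 4 ^ k \<le> real ((2 * k) choose k) / 4 ^ k"
      by (intro divide_right_mono) (auto simp: binomial_maximum')
    then show "real ((2 * k) choose i) / 4 ^ k \<le> 1 / sqrt (2 * real k + 1)"
      using central_binomial_le[of k] by linarith
  qed auto
  also have "\<dots> = 1 / sqrt (2 * real k + 1) * (\<Sum>i\<le>2*k. exp (- ((real i - real k) * y)\<^sup>2 / 2))"
    by (simp add: sum_distrib_left)
  also have "\<dots> \<le> 1 / sqrt (2 * real k + 1) * 6"
    by (intro mult_left_mono sum_gauss_le assms) auto
  finally show ?thesis by simp
qed

text \<open>With \<open>x = sin\<^sup>2 u\<close> this compares \<open>exp (- a sin\<^sup>2 u)\<close> with an even power of \<open>cos u\<close>, up to an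
  exponentially small error.\<close>

lemma exp_neg_le_power_plus:
  fixes a x :: real
  assumes a: "0 \<le> a" and x: "0 \<le> x" "x \<le> 1"
  shows "exp (- a * x) \<le> (1 - x) ^ nat \<lfloor>a / 2\<rfloor> + exp (- a / 2)"
proof (cases "x \<le> 1 / 2")
  case True
  define m where "m = nat \<lfloor>a / 2\<rfloor>"
  have m: "2 * real m \<le> a" using a unfolding m_def by linarith
  \<comment> \<open>\<open>exp (- 2 x) \<le> 1 - x\<close> uses that \<open>x \<le> 1 / 2\<close> here.\<close>
  have "1 + 2 * x \<le> exp (2 * x)" by (rule exp_ge_add_one_self)
  then have "exp (- 2 * x) \<le> 1 / (1 + 2 * x)"
    using x by (simp add: exp_minus field_simps)
  also have "\<dots> \<le> 1 - x"
  proof -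
    have "0 \<le> x * (1 - 2 * x)" using True x by simp
    then show ?thesis using x by (simp add: field_simps)
  qed
  finally have *: "exp (- 2 * x) \<le> 1 - x" .
  have "exp (- a * x) \<le> exp (real m * (- 2 * x))"
    using mult_right_mono[OF m x(1)] by (simp add: algebra_simps)
  also have "\<dots> = exp (- 2 * x) ^ m" by (rule exp_of_nat_mult)
  also have "\<dots> \<le> (1 - x) ^ m" by (intro power_mono *) auto
  finally show ?thesis unfolding m_def by (simp add: add_increasing2)
next
  case False
  then have "a * (1 / 2) \<le> a * x" using a by (intro mult_left_mono) auto
  then have "exp (- a * x) \<le> exp (- a / 2)" by simp
  then show ?thesis using x by (simp add: add_increasing)
qed

lemma integral_exp_sin_le:
  fixes a y :: real
  assumes a: "a > 0" and y: "\<bar>y\<bar> \<ge> 1"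
  shows "(\<integral>z. exp (- a * (sin (y * z / 2))\<^sup>2) \<partial>std_normal_distribution) \<le> 10 / sqrt a"
proof -
  interpret G: real_distribution std_normal_distribution by (rule real_dist_normal_dist)
  define m where "m = nat \<lfloor>a / 2\<rfloor>"
  have "a / 2 < real m + 1" using a unfolding m_def by simp
  then have m: "a \<le> 2 * (2 * real m + 1)" by simp
  have intc: "integrable std_normal_distribution (\<lambda>z. cos (y * z / 2) ^ (2 * m))"
    by (rule G.integrable_const_bound[where B=1]) (auto simp: power_abs intro!: power_le_one)
  have "(\<integral>z. exp (- a * (sin (y * z / 2))\<^sup>2) \<partial>std_normal_distribution) \<le> (\<integral>z. cos (y * z / 2) ^ (2 * m) + exp (- a / 2) \<partial>std_normal_distribution)"
  proof (rule integral_mono)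
    show "integrable std_normal_distribution (\<lambda>z. exp (- a * (sin (y * z / 2))\<^sup>2))"
      using a by (intro G.integrable_const_bound[where B=1]) auto
    show "integrable std_normal_distribution (\<lambda>z. cos (y * z / 2) ^ (2 * m) + exp (- a / 2))"
      using intc by simp
    fix z
    show "exp (- a * (sin (y * z / 2))\<^sup>2) \<le> cos (y * z / 2) ^ (2 * m) + exp (- a / 2)"
      using exp_neg_le_power_plus[of a "(sin (y * z / 2))\<^sup>2"] a
      by (simp add: m_def power_mult cos_squared_eq abs_square_le_1)
  qed
  also have "\<dots> = (\<integral>z. cos (y * z / 2) ^ (2 * m) \<partial>std_normal_distribution) + exp (- a / 2)"
    using intc G.prob_space by simp
  also have "\<dots> \<le> 6 / sqrt (2 * real m + 1) + exp (- a / 2)"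
    by (intro add_right_mono integral_cos_even_power_le y)
  also have "6 / sqrt (2 * real m + 1) \<le> 9 / sqrt a"
  proof -
    have "(6 * sqrt a)\<^sup>2 \<le> (9 * sqrt (2 * real m + 1))\<^sup>2"
      using m a by (simp add: power_mult_distrib)
    then have "6 * sqrt a \<le> 9 * sqrt (2 * real m + 1)"
      by (rule power2_le_imp_le) simp
    then show ?thesis using a by (simp add: field_simps)
  qed
  also have "exp (- a / 2) \<le> 1 / sqrt a"
  proof -
    have "sqrt a \<le> sqrt (exp a)" using exp_ge_add_one_self[of a] by (intro real_sqrt_le_mono) linarith
    also have "sqrt (exp a) = exp (a / 2)"
      by (rule real_sqrt_unique) (auto simp: exp_double[symmetric])
    finally show ?thesis using a by (simp add: exp_minus field_simps)
  qed
  finally show ?thesis by (simp add: field_simps)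
qed

section \<open>Concentration of sums of independent variables\<close>

lemma cmod_char_squared:
  assumes "real_distribution \<mu>"
  shows "(cmod (char \<mu> t))\<^sup>2 = (\<integral>(x, y). cos (t * (x - y)) \<partial>(\<mu> \<Otimes>\<^sub>M \<mu>))"
proof -
  interpret real_distribution \<mu> by fact
  interpret P: pair_prob_space \<mu> \<mu> ..
  have int: "integrable (\<mu> \<Otimes>\<^sub>M \<mu>) (\<lambda>(x, y). iexp (t * (x - y)))"
    by (rule P.integrable_const_bound[where B=1]) (auto simp: split_beta simp del: of_real_mult of_real_diff)
  have "complex_of_real ((cmod (char \<mu> t))\<^sup>2) = char \<mu> t * cnj (char \<mu> t)"
    by (rule complex_norm_square)
  also have "cnj (char \<mu> t) = (\<integral>y. iexp (- (t * y)) \<partial>\<mu>)"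
    unfolding char_def Bochner_Integration.integral_cnj[symmetric] by (simp add: exp_cnj)
  also have "char \<mu> t * \<dots> = (\<integral>x. \<integral>y. iexp (t * x) * iexp (- (t * y)) \<partial>\<mu> \<partial>\<mu>)"
    unfolding char_def by simp
  also have "\<dots> = (\<integral>x. \<integral>y. iexp (t * (x - y)) \<partial>\<mu> \<partial>\<mu>)"
    by (simp add: exp_add[symmetric] algebra_simps)
  also have "\<dots> = (\<integral>(x, y). iexp (t * (x - y)) \<partial>(\<mu> \<Otimes>\<^sub>M \<mu>))"
    using P.integral_fst'[OF int] by simp
  finally have "(cmod (char \<mu> t))\<^sup>2 = Re (\<integral>(x, y). iexp (t * (x - y)) \<partial>(\<mu> \<Otimes>\<^sub>M \<mu>))"
    by (metis Re_complex_of_real)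
  also have "\<dots> = (\<integral>(x, y). cos (t * (x - y)) \<partial>(\<mu> \<Otimes>\<^sub>M \<mu>))"
    by (subst integral_Re[OF int, symmetric]) (simp add: case_prod_unfold Re_exp)
  finally show ?thesis .
qed

text \<open>For independent \<open>x, y\<close> with law \<open>\<mu>\<close> and \<open>J = E sin\<^sup>2 (t (x - y) / 2)\<close>, the squared modulus of the
  characteristic function is \<open>1 - 2 J\<close>; then use \<open>2 c \<le> 1 + c\<^sup>2\<close> and \<open>1 - J \<le> exp (- J)\<close>.\<close>

lemma cmod_char_power_le:
  assumes "real_distribution \<mu>"
  shows "cmod (char \<mu> t) ^ n \<le> exp (- real n * (\<integral>(x, y). (sin (t * (x - y) / 2))\<^sup>2 \<partial>(\<mu> \<Otimes>\<^sub>M \<mu>)))"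
proof -
  interpret real_distribution \<mu> by fact
  interpret P: pair_prob_space \<mu> \<mu> ..
  define J where "J = (\<integral>(x, y). (sin (t * (x - y) / 2))\<^sup>2 \<partial>(\<mu> \<Otimes>\<^sub>M \<mu>))"
  have int: "integrable (\<mu> \<Otimes>\<^sub>M \<mu>) (\<lambda>(x, y). (sin (t * (x - y) / 2))\<^sup>2)"
    by (rule P.integrable_const_bound[where B=1]) (auto simp: split_beta abs_square_le_1)
  have cos_eq: "cos (t * (x - y)) = 1 - 2 * (sin (t * (x - y) / 2))\<^sup>2" for x y
    using cos_double_sin[of "t * (x - y) / 2"] by simp
  have "(cmod (char \<mu> t))\<^sup>2 = (\<integral>p. 1 - 2 * (case p of (x, y) \<Rightarrow> (sin (t * (x - y) / 2))\<^sup>2) \<partial>(\<mu> \<Otimes>\<^sub>M \<mu>))"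
    unfolding cmod_char_squared[OF assms] cos_eq by (simp add: case_prod_unfold)
  also have "\<dots> = 1 - 2 * J"
    unfolding J_def using int P.prob_space by (subst Bochner_Integration.integral_diff) auto
  finally have sq: "(cmod (char \<mu> t))\<^sup>2 = 1 - 2 * J" .
  have "0 \<le> (1 - cmod (char \<mu> t))\<^sup>2" by simp
  then have "cmod (char \<mu> t) \<le> 1 + - J"
    using sq by (simp add: power2_diff)
  also have "\<dots> \<le> exp (- J)" by (rule exp_ge_add_one_self)
  finally have "cmod (char \<mu> t) ^ n \<le> exp (- J) ^ n"
    by (intro power_mono) auto
  then show ?thesis
    by (simp add: J_def exp_of_nat_mult[symmetric])
qed

text \<open>Jensen's inequality for \<open>exp\<close> under the measure conditioned on \<open>A\<close>, after discarding the part
  of the integral outside \<open>A\<close>.\<close>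

lemma (in finite_measure) exp_integral_le_set_average:
  fixes f :: "'a \<Rightarrow> real"
  assumes [measurable]: "f \<in> borel_measurable M" "A \<in> sets M"
    and f: "\<And>x. 0 \<le> f x" "\<And>x. f x \<le> 1" and c: "c \<ge> 0" and p: "measure M A > 0"
  shows "exp (- c * (\<integral>x. f x \<partial>M)) \<le>
    (\<integral>x. indicator A x * exp (- (c * measure M A) * f x) \<partial>M) / measure M A"
proof -
  define p where "p = measure M A"
  define m where "m = (\<integral>x. indicator A x * f x \<partial>M) / p"
  define b where "b = c * p"
  have p0: "p > 0" and b0: "b \<ge> 0" using p c by (auto simp: p_def b_def)
  have intf: "integrable M f"
    using f by (intro integrable_const_bound[where B=1]) auto
  have intAf: "integrable M (\<lambda>x. indicator A x * f x)"
    using f by (intro integrable_const_bound[where B=1]) (auto simp: indicator_def)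
  have intA: "integrable M (indicator A :: 'a \<Rightarrow> real)"
    by (auto simp: less_top[symmetric])
  \<comment> \<open>Integrate over \<open>A\<close> the tangent line of \<open>exp (- b s)\<close> at the conditional mean \<open>s = m\<close>.\<close>
  have "p * exp (- b * m) = exp (- b * m) * ((1 + b * m) * p - b * (\<integral>x. indicator A x * f x \<partial>M))"
    using p0 by (simp add: m_def field_simps)
  also have "\<dots> = (\<integral>x. exp (- b * m) * ((1 + b * m) * indicator A x - b * (indicator A x * f x)) \<partial>M)"
    using intAf intA by (simp add: p_def Bochner_Integration.integral_diff)
  also have "\<dots> \<le> (\<integral>x. indicator A x * exp (- b * f x) \<partial>M)"
  proof (rule integral_mono)
    show "integrable M (\<lambda>x. exp (- b * m) * ((1 + b * m) * indicator A x - b * (indicator A x * f x)))"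
      using intAf by (intro integrable_mult_right Bochner_Integration.integrable_diff)
        (auto simp: less_top[symmetric])
    show "integrable M (\<lambda>x. indicator A x * exp (- b * f x))"
      using f b0 by (intro integrable_const_bound[where B=1]) (auto simp: indicator_def)
    fix x
    have "exp (- b * m) * (1 + (b * m - b * f x)) \<le> exp (- b * m) * exp (b * m - b * f x)"
      by (intro mult_left_mono exp_ge_add_one_self) auto
    also have "\<dots> = exp (- b * f x)" by (simp add: exp_add[symmetric])
    finally show "exp (- b * m) * ((1 + b * m) * indicator A x - b * (indicator A x * f x))
        \<le> indicator A x * exp (- b * f x)"
      by (auto simp: indicator_def algebra_simps)
  qed
  finally have "exp (- b * m) \<le> (\<integral>x. indicator A x * exp (- b * f x) \<partial>M) / p"
    using p0 by (simp add: field_simps)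
  moreover have "exp (- c * (\<integral>x. f x \<partial>M)) \<le> exp (- b * m)"
  proof -
    have "(\<integral>x. indicator A x * f x \<partial>M) \<le> (\<integral>x. f x \<partial>M)"
      using f by (intro integral_mono intf intAf) (auto simp: indicator_def)
    then show ?thesis
      using p0 c by (simp add: b_def m_def mult_left_mono)
  qed
  ultimately have "exp (- c * (\<integral>x. f x \<partial>M)) \<le> (\<integral>x. indicator A x * exp (- b * f x) \<partial>M) / p"
    by linarith
  then show ?thesis
    by (simp only: p_def b_def)
qed

text \<open>The probability that two independent variables with law \<open>\<mu>\<close> are at distance at least \<open>l\<close>, i.e. the
  tail of the symmetrized law.\<close>

definition difference_tail :: "real measure \<Rightarrow> real \<Rightarrow> real" where
  "difference_tail \<mu> l = measure (\<mu> \<Otimes>\<^sub>M \<mu>) {(x, y). l \<le> \<bar>x - y\<bar>}"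

lemma sets_far_pairs:
  assumes "sets \<mu> = sets borel"
  shows "{(x::real, y). l \<le> \<bar>x - y\<bar>} \<in> sets (\<mu> \<Otimes>\<^sub>M \<mu>)"
proof -
  have "{w \<in> space (borel \<Otimes>\<^sub>M borel). l \<le> \<bar>fst w - snd w\<bar>} \<in> sets (borel \<Otimes>\<^sub>M (borel :: real measure))"
    by measurable
  then show ?thesis
    using assms by (simp add: case_prod_unfold space_pair_measure cong: sets_pair_measure_cong)
qed

text \<open>By Jensen's inequality on the event that \<open>x\<close> and \<open>y\<close> are at distance at least \<open>l\<close>, it suffices to
  bound the Gaussian average for one fixed difference \<open>x - y\<close>, whose size relative to \<open>l\<close> is at least 1.\<close>

lemma integral_cmod_char_power_le:
  assumes "real_distribution \<mu>" and l: "l > 0" and p: "difference_tail \<mu> l > 0" and n: "n > 0"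
  shows "(\<integral>z. cmod (char \<mu> (z / l)) ^ n \<partial>std_normal_distribution) \<le> 10 / sqrt (real n * difference_tail \<mu> l)"
proof -
  interpret real_distribution \<mu> by fact
  interpret P: pair_prob_space \<mu> \<mu> ..
  interpret G: real_distribution std_normal_distribution by (rule real_dist_normal_dist)
  interpret Q: pair_prob_space std_normal_distribution "\<mu> \<Otimes>\<^sub>M \<mu>" ..
  define A where "A = {(x::real, y). l \<le> \<bar>x - y\<bar>}"
  define q where "q = difference_tail \<mu> l"
  define a where "a = real n * q"
  define g where "g z w = indicator A w * exp (- a * (sin (z / l * (fst w - snd w) / 2))\<^sup>2)" for z w
  have q: "q = measure (\<mu> \<Otimes>\<^sub>M \<mu>) A" "q > 0" using p by (auto simp: q_def difference_tail_def A_def)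
  have a: "a > 0" using n q by (simp add: a_def)
  have A[measurable]: "A \<in> sets (\<mu> \<Otimes>\<^sub>M \<mu>)"
    unfolding A_def by (rule sets_far_pairs) simp
  have g_bounds: "0 \<le> g z w" "g z w \<le> 1" for z w
    using a by (auto simp: g_def indicator_def)
  have int_g: "integrable (std_normal_distribution \<Otimes>\<^sub>M (\<mu> \<Otimes>\<^sub>M \<mu>)) (case_prod g)"
    using g_bounds unfolding g_def
    by (intro Q.integrable_const_bound[where B=1]) (auto simp: split_beta)
  have "(\<integral>z. cmod (char \<mu> (z / l)) ^ n \<partial>std_normal_distribution) \<le> (\<integral>z. (\<integral>w. g z w \<partial>(\<mu> \<Otimes>\<^sub>M \<mu>)) / q \<partial>std_normal_distribution)"
  proof (rule integral_mono)
    show "integrable std_normal_distribution (\<lambda>z. cmod (char \<mu> (z / l)) ^ n)"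
      using cmod_char_le_1 by (intro G.integrable_const_bound[where B=1]) (auto intro!: power_le_one)
    show "integrable std_normal_distribution (\<lambda>z. (\<integral>w. g z w \<partial>(\<mu> \<Otimes>\<^sub>M \<mu>)) / q)"
      using Q.integrable_fst'[OF int_g] by simp
    fix z
    have "exp (- real n * (\<integral>w. (sin (z / l * (fst w - snd w) / 2))\<^sup>2 \<partial>(\<mu> \<Otimes>\<^sub>M \<mu>))) \<le>
      (\<integral>w. g z w \<partial>(\<mu> \<Otimes>\<^sub>M \<mu>)) / q"
      unfolding g_def a_def q(1)
      by (rule P.exp_integral_le_set_average) (use q A in \<open>auto simp: abs_square_le_1\<close>)
    then show "cmod (char \<mu> (z / l)) ^ n \<le> (\<integral>w. g z w \<partial>(\<mu> \<Otimes>\<^sub>M \<mu>)) / q"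
      using cmod_char_power_le[OF assms(1), of "z / l" n] by (simp add: case_prod_unfold)
  qed
  also have "\<dots> = (\<integral>w. (\<integral>z. g z w \<partial>std_normal_distribution) \<partial>(\<mu> \<Otimes>\<^sub>M \<mu>)) / q"
    using Q.Fubini_integral[OF int_g] by simp
  also have "\<dots> \<le> (\<integral>w. indicator A w * (10 / sqrt a) \<partial>(\<mu> \<Otimes>\<^sub>M \<mu>)) / q"
  proof (intro divide_right_mono integral_mono)
    show "integrable (\<mu> \<Otimes>\<^sub>M \<mu>) (\<lambda>w. \<integral>z. g z w \<partial>std_normal_distribution)"
      by (rule Q.integrable_snd[OF int_g])
    show "integrable (\<mu> \<Otimes>\<^sub>M \<mu>) (\<lambda>w. indicator A w * (10 / sqrt a))"
      using A by (intro integrable_mult_left) (auto simp: less_top[symmetric])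
    fix w :: "real \<times> real"
    show "(\<integral>z. g z w \<partial>std_normal_distribution) \<le> indicator A w * (10 / sqrt a)"
    proof (cases "w \<in> A")
      case True
      then have "1 \<le> \<bar>(fst w - snd w) / l\<bar>" using l by (simp add: A_def split_beta)
      from integral_exp_sin_le[OF a this] show ?thesis
        using True by (simp add: g_def mult_ac)
    qed (simp add: g_def)
  qed (use q in auto)
  also have "\<dots> = 10 / sqrt a"
    using q sets.Int_space_eq2[OF A] by simp
  finally show ?thesis by (simp add: a_def q_def)
qed

text \<open>A concentration inequality of Kolmogorov--Rogozin type: a sum of \<open>n\<close> independent variables with law
  \<open>\<mu>\<close> lies in an interval of length comparable to \<open>l\<close> around 0 with probability at most of order
  \<open>1 / sqrt (n * difference_tail \<mu> l)\<close>. The law \<open>\<nu>\<close> of the sum enters only through its characteristic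
  function. The proof is Markov's inequality for \<open>exp (- (x / l)\<^sup>2 / 2)\<close>.\<close>

lemma measure_char_power_le:
  assumes "real_distribution \<mu>" "real_distribution \<nu>"
    and char: "\<And>t. char \<nu> t = char \<mu> t ^ n"
    and l: "l > 0" and p: "difference_tail \<mu> l > 0" and n: "n > 0"
  shows "measure \<nu> {x. \<bar>x\<bar> \<le> k * l} \<le> exp (k\<^sup>2 / 2) * 10 / sqrt (real n * difference_tail \<mu> l)"
proof -
  interpret N: real_distribution \<nu> by fact
  have int: "integrable \<nu> (\<lambda>x. exp (- (1 / l * x)\<^sup>2 / 2))"
    by (rule N.integrable_const_bound[where B=1]) auto
  have "measure \<nu> {x. \<bar>x\<bar> \<le> k * l} = (\<integral>x. indicator {x. \<bar>x\<bar> \<le> k * l} x \<partial>\<nu>)"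
    by simp
  also have "\<dots> \<le> (\<integral>x. exp (k\<^sup>2 / 2) * exp (- (1 / l * x)\<^sup>2 / 2) \<partial>\<nu>)"
  proof (rule integral_mono)
    show "integrable \<nu> (indicator {x. \<bar>x\<bar> \<le> k * l} :: real \<Rightarrow> real)"
      by (auto simp: less_top[symmetric])
    show "integrable \<nu> (\<lambda>x. exp (k\<^sup>2 / 2) * exp (- (1 / l * x)\<^sup>2 / 2))"
      using int by simp
    fix x
    show "indicator {x. \<bar>x\<bar> \<le> k * l} x \<le> exp (k\<^sup>2 / 2) * exp (- (1 / l * x)\<^sup>2 / 2)"
    proof (cases "\<bar>x\<bar> \<le> k * l")
      case True
      then have "0 \<le> k * l" by linarith
      then have "0 \<le> k" using l by (simp add: zero_le_mult_iff)
      then have "\<bar>1 / l * x\<bar> \<le> \<bar>k\<bar>" using l True by (simp add: pos_divide_le_eq)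
      then have "(1 / l * x)\<^sup>2 \<le> k\<^sup>2" by (simp only: abs_le_square_iff)
      then have "1 \<le> exp (k\<^sup>2 / 2 + - (1 / l * x)\<^sup>2 / 2)" by simp
      then show ?thesis using True by (simp only: exp_add) simp
    qed simp
  qed
  also have "\<dots> = exp (k\<^sup>2 / 2) * (\<integral>x. exp (- (1 / l * x)\<^sup>2 / 2) \<partial>\<nu>)"
    by simp
  also have "\<dots> \<le> exp (k\<^sup>2 / 2) * (\<integral>z. cmod (char \<mu> (z / l)) ^ n \<partial>std_normal_distribution)"
    using integral_gauss_le_integral_cmod_char[OF assms(2), of "1 / l"]
    by (intro mult_left_mono) (auto simp: char norm_power)
  also have "\<dots> \<le> exp (k\<^sup>2 / 2) * (10 / sqrt (real n * difference_tail \<mu> l))"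
    by (intro mult_left_mono integral_cmod_char_power_le assms) auto
  finally show ?thesis by simp
qed

section \<open>The tail of a law evaluated at the variable itself\<close>

text \<open>The two-sided tail \<open>P(\<bar>X\<bar> \<ge> s)\<close> of a variable \<open>X\<close> with law \<open>\<mu>\<close>.\<close>

definition abs_tail :: "real measure \<Rightarrow> real \<Rightarrow> real" where
  "abs_tail \<mu> s = measure \<mu> {x. s \<le> \<bar>x\<bar>}"

text \<open>If \<open>k\<close> is maximal with \<open>q \<le> (1 / 2) ^ k\<close>, then the \<open>k\<close>-th summand alone dominates the left-hand side.\<close>

lemma inverse_sqrt_le_suminf:
  assumes q: "0 < q" "q \<le> (1::real)"
  shows "ennreal (1 / sqrt q) \<le> (\<Sum>k. ennreal (sqrt 2 ^ Suc k) * indicator {r. r \<le> (1 / 2) ^ k} q)"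
proof -
  define j where "j = (LEAST j. (1 / 2) ^ j < q)"
  have ex: "\<exists>j. (1 / 2) ^ j < q" using real_arch_pow_inv[of q "1 / 2"] q by auto
  have j: "(1 / 2) ^ j < q" unfolding j_def by (rule LeastI_ex[OF ex])
  have "j \<noteq> 0" using j q by (cases j) auto
  then obtain k where k: "j = Suc k" by (cases j) auto
  have qk: "q \<le> (1 / 2) ^ k"
    using not_less_Least[of k "\<lambda>j. (1 / 2) ^ j < q"] k unfolding j_def by auto
  have "1 / sqrt q \<le> sqrt 2 ^ Suc k"
  proof -
    have "1 = sqrt (1 / 2) ^ Suc k * sqrt 2 ^ Suc k"
      by (simp add: power_mult_distrib[symmetric] real_sqrt_mult[symmetric] del: power_Suc)
    also have "\<dots> \<le> sqrt q * sqrt 2 ^ Suc k"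
      using j unfolding k real_sqrt_power[symmetric] by (intro mult_right_mono) (auto simp del: power_Suc)
    finally show ?thesis using q by (simp add: field_simps)
  qed
  then have "ennreal (1 / sqrt q) \<le> (\<Sum>k\<in>{k}. ennreal (sqrt 2 ^ Suc k) * indicator {r. r \<le> (1 / 2) ^ k} q)"
    using qk by (simp add: ennreal_leI del: power_Suc)
  also have "\<dots> \<le> (\<Sum>k. ennreal (sqrt 2 ^ Suc k) * indicator {r. r \<le> (1 / 2) ^ k} q)"
    by (intro sum_le_suminf) auto
  finally show ?thesis .
qed

context real_distribution
begin

lemma abs_tail_antimono: "s \<le> t \<Longrightarrow> abs_tail M t \<le> abs_tail M s"
  unfolding abs_tail_def by (intro finite_measure_mono) auto

lemma abs_tail_le_1: "abs_tail M s \<le> 1"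
  unfolding abs_tail_def by simp

lemma abs_tail_measurable [measurable]: "abs_tail M \<in> borel_measurable borel"
proof -
  have "(\<lambda>s. - abs_tail M s) \<in> borel_measurable borel"
    by (rule borel_measurable_mono) (simp add: mono_def abs_tail_antimono)
  then have "(\<lambda>s. - (- abs_tail M s)) \<in> borel_measurable borel" by measurable
  then show ?thesis by simp
qed

text \<open>The tail function evaluated at the variable itself is stochastically at least uniform on \<open>[0, 1]\<close>.
  Unless it is empty, the set in question has the form \<open>\<bar>x\<bar> \<ge> s\<close> or \<open>\<bar>x\<bar> > s\<close>; in the second case it is an increasing
  union of sets of the first form.\<close>

lemma measure_abs_tail_le:
  assumes u: "0 \<le> u"
  shows "measure M {x. abs_tail M \<bar>x\<bar> \<le> u} \<le> u"
proof (cases "{x. abs_tail M \<bar>x\<bar> \<le> u} = {}")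
  case True
  then show ?thesis using u by simp
next
  case False
  define D where "D = abs ` {x. abs_tail M \<bar>x\<bar> \<le> u}"
  define s where "s = Inf D"
  have D: "D \<noteq> {}" "bdd_below D" using False by (auto simp: D_def intro!: bdd_belowI[of _ 0])
  have D_tail: "abs_tail M d \<le> u" if "d \<in> D" for d using that by (auto simp: D_def)
  show ?thesis
  proof (cases "s \<in> D")
    case True
    have "{x. abs_tail M \<bar>x\<bar> \<le> u} \<subseteq> {x. s \<le> \<bar>x\<bar>}"
      unfolding s_def using D by (auto simp: D_def intro!: cInf_lower)
    then have "measure M {x. abs_tail M \<bar>x\<bar> \<le> u} \<le> abs_tail M s"
      unfolding abs_tail_def by (intro finite_measure_mono) auto
    also have "\<dots> \<le> u" by (rule D_tail[OF True])
    finally show ?thesis .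
  next
    case False
    have tail: "abs_tail M (s + 1 / real (Suc n)) \<le> u" for n
    proof -
      obtain d where "d \<in> D" "d < s + 1 / real (Suc n)"
        using cInf_lessD[OF D(1), of "s + 1 / real (Suc n)"] by (auto simp: s_def)
      then show ?thesis
        using abs_tail_antimono[of d "s + 1 / real (Suc n)"] D_tail[of d] by linarith
    qed
    have "{x. abs_tail M \<bar>x\<bar> \<le> u} \<subseteq> (\<Union>n. {x. s + 1 / real (Suc n) \<le> \<bar>x\<bar>})"
    proof
      fix x assume "x \<in> {x. abs_tail M \<bar>x\<bar> \<le> u}"
      then have "\<bar>x\<bar> \<in> D" by (auto simp: D_def)
      then have "s \<le> \<bar>x\<bar>" "s \<noteq> \<bar>x\<bar>" using D(2) False by (auto simp: s_def intro: cInf_lower)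
      then obtain n where "1 / real (Suc n) < \<bar>x\<bar> - s"
        using reals_Archimedean[of "\<bar>x\<bar> - s"] by (auto simp: inverse_eq_divide)
      then show "x \<in> (\<Union>n. {x. s + 1 / real (Suc n) \<le> \<bar>x\<bar>})"
        by (auto intro!: exI[of _ n])
    qed
    then have "measure M {x. abs_tail M \<bar>x\<bar> \<le> u} \<le> measure M (\<Union>n. {x. s + 1 / real (Suc n) \<le> \<bar>x\<bar>})"
      by (intro finite_measure_mono) auto
    also have "\<dots> \<le> u"
    proof (rule LIMSEQ_le_const2)
      show "(\<lambda>n. measure M {x. s + 1 / real (Suc n) \<le> \<bar>x\<bar>}) \<longlonglongrightarrow>
          measure M (\<Union>n. {x. s + 1 / real (Suc n) \<le> \<bar>x\<bar>})"
      proof (rule finite_Lim_measure_incseq)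
        show "incseq (\<lambda>n. {x. s + 1 / real (Suc n) \<le> \<bar>x\<bar>})"
        proof (rule incseq_SucI, rule subsetI)
          fix n x assume "x \<in> {x. s + 1 / real (Suc n) \<le> \<bar>x\<bar>}"
          moreover have "1 / real (Suc (Suc n)) \<le> 1 / real (Suc n)" by (intro frac_le) auto
          ultimately show "x \<in> {x. s + 1 / real (Suc (Suc n)) \<le> \<bar>x\<bar>}" by simp
        qed
      qed auto
      show "\<exists>N. \<forall>n\<ge>N. measure M {x. s + 1 / real (Suc n) \<le> \<bar>x\<bar>} \<le> u"
        using tail by (auto simp: abs_tail_def)
    qed
    finally show ?thesis .
  qed
qed

lemma AE_abs_tail_pos: "AE x in M. abs_tail M \<bar>x\<bar> > 0"
proof -
  have "measure M {x. abs_tail M \<bar>x\<bar> \<le> 0} = 0"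
    using measure_abs_tail_le[of 0] by (simp add: measure_le_0_iff)
  then have "AE x in M. x \<notin> {x. abs_tail M \<bar>x\<bar> \<le> 0}"
    by (subst (asm) prob_eq_0) auto
  then show ?thesis by (simp add: not_le)
qed

text \<open>A function that is stochastically at least uniform has an integrable inverse square root: over
  the dyadic level sets the integral is bounded by a geometric series of ratio \<open>1 / sqrt 2\<close>.\<close>

lemma integrable_inverse_sqrt_abs_tail: "integrable M (\<lambda>x. 1 / sqrt (abs_tail M \<bar>x\<bar>))"
proof (rule integrableI_nonneg)
  show "AE x in M. 0 \<le> 1 / sqrt (abs_tail M \<bar>x\<bar>)"
    by (simp add: abs_tail_def)
  have "(\<integral>\<^sup>+x. ennreal (1 / sqrt (abs_tail M \<bar>x\<bar>)) \<partial>M) \<le>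
      (\<integral>\<^sup>+x. (\<Sum>k. ennreal (sqrt 2 ^ Suc k) * indicator {r. r \<le> (1 / 2) ^ k} (abs_tail M \<bar>x\<bar>)) \<partial>M)"
    using AE_abs_tail_pos
    by (intro nn_integral_mono_AE) (auto elim!: eventually_mono intro!: inverse_sqrt_le_suminf abs_tail_le_1 simp del: power_Suc)
  also have "\<dots> = (\<Sum>k. \<integral>\<^sup>+x. ennreal (sqrt 2 ^ Suc k) * indicator {x. abs_tail M \<bar>x\<bar> \<le> (1 / 2) ^ k} x \<partial>M)"
    by (subst nn_integral_suminf[symmetric]) (auto simp: indicator_def intro!: nn_integral_cong)
  also have "\<dots> \<le> (\<Sum>k. ennreal (sqrt 2 * (1 / sqrt 2) ^ k))"
  proof (intro suminf_le allI)
    fix k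
    have "(\<integral>\<^sup>+x. ennreal (sqrt 2 ^ Suc k) * indicator {x. abs_tail M \<bar>x\<bar> \<le> (1 / 2) ^ k} x \<partial>M)
        = ennreal (sqrt 2 ^ Suc k) * emeasure M {x. abs_tail M \<bar>x\<bar> \<le> (1 / 2) ^ k}"
      by (subst nn_integral_cmult_indicator) auto
    also have "\<dots> \<le> ennreal (sqrt 2 ^ Suc k) * ennreal ((1 / 2) ^ k)"
      unfolding emeasure_eq_measure by (intro mult_left_mono ennreal_leI measure_abs_tail_le) auto
    also have "\<dots> = ennreal (sqrt 2 ^ Suc k * (1 / 2) ^ k)"
      by (simp add: ennreal_mult)
    also have "sqrt 2 ^ Suc k * (1 / 2) ^ k = sqrt 2 * (1 / sqrt 2) ^ k"
    proof -
      have "sqrt 2 * (1 / 2) = 1 / sqrt (2::real)" by (simp add: real_div_sqrt field_simps)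
      then show ?thesis by (simp only: power_Suc mult.assoc power_mult_distrib[symmetric])
    qed
    finally show "(\<integral>\<^sup>+x. ennreal (sqrt 2 ^ Suc k) * indicator {x. abs_tail M \<bar>x\<bar> \<le> (1 / 2) ^ k} x \<partial>M)
        \<le> ennreal (sqrt 2 * (1 / sqrt 2) ^ k)" .
  qed auto
  also have "\<dots> < \<infinity>"
  proof -
    have "summable (\<lambda>k. sqrt 2 * (1 / sqrt 2 :: real) ^ k)"
      by (intro summable_mult summable_geometric) auto
    then show ?thesis by (subst suminf_ennreal2) auto
  qed
  finally show "(\<integral>\<^sup>+x. ennreal (1 / sqrt (abs_tail M \<bar>x\<bar>)) \<partial>M) < \<infinity>" .
qed simp

lemma ex_median_bound: "\<exists>m>0. measure M {x. \<bar>x\<bar> \<le> m} \<ge> 1 / 2"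
proof -
  have "(\<lambda>n. measure M {x. \<bar>x\<bar> \<le> real n}) \<longlonglongrightarrow> measure M (\<Union>n. {x. \<bar>x\<bar> \<le> real n})"
    by (rule finite_Lim_measure_incseq) (auto simp: incseq_def)
  also have "(\<Union>n. {x. \<bar>x\<bar> \<le> real n}) = space M"
    using real_arch_simple by auto
  finally have "(\<lambda>n. measure M {x. \<bar>x\<bar> \<le> real n}) \<longlonglongrightarrow> 1"
    by (simp only: prob_space)
  then have "eventually (\<lambda>n. measure M {x. \<bar>x\<bar> \<le> real n} > 1 / 2) sequentially"
    by (rule order_tendstoD) simp
  with eventually_gt_at_top[of 0] have "eventually (\<lambda>n. n > 0 \<and> measure M {x. \<bar>x\<bar> \<le> real n} > 1 / 2) sequentially"
    by (rule eventually_conj)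
  then obtain n where "n > 0" "measure M {x. \<bar>x\<bar> \<le> real n} > 1 / 2"
    by (auto simp: eventually_sequentially)
  then show ?thesis by (intro exI[of _ "real n"]) auto
qed

text \<open>If one of two independent copies has modulus at least \<open>s\<close> and the other at most \<open>m\<close>, they are
  at distance at least \<open>s - m\<close>.\<close>

lemma difference_tail_ge_abs_tail:
  assumes "measure M {x. \<bar>x\<bar> \<le> m} \<ge> 1 / 2"
  shows "difference_tail M (s - m) \<ge> abs_tail M s / 2"
proof -
  interpret P: pair_prob_space M M ..
  have "abs_tail M s * (1 / 2) \<le> measure M {x. s \<le> \<bar>x\<bar>} * measure M {x. \<bar>x\<bar> \<le> m}"
    unfolding abs_tail_def by (intro mult_left_mono assms) auto
  also have "\<dots> = measure (M \<Otimes>\<^sub>M M) ({x. s \<le> \<bar>x\<bar>} \<times> {x. \<bar>x\<bar> \<le> m})"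
    by (simp add: measure_def emeasure_pair_measure_Times enn2real_mult)
  also have "\<dots> \<le> measure (M \<Otimes>\<^sub>M M) {(x, y). s - m \<le> \<bar>x - y\<bar>}"
  proof (intro P.finite_measure_mono)
    show "{(x, y). s - m \<le> \<bar>x - y\<bar>} \<in> sets (M \<Otimes>\<^sub>M M)"
      by (rule sets_far_pairs) simp
  qed auto
  finally show ?thesis by (simp add: difference_tail_def)
qed

text \<open>The concentration inequality at the scale \<open>\<bar>x\<bar> + R\<close>, with a bound in terms of the tail of \<open>M\<close> at
  \<open>\<bar>x\<bar>\<close>. For large \<open>\<bar>x\<bar>\<close> the scale \<open>l\<close> of the inequality is \<open>\<bar>x\<bar> - m\<close>, where \<open>m\<close> bounds the modulus with
  probability at least \<open>1 / 2\<close>; for bounded \<open>\<bar>x\<bar>\<close> any fixed scale at which the law is spread out does.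
  The constant is uniform in \<open>n\<close> and \<open>x\<close>.\<close>

lemma ex_concentration_bound:
  assumes l: "l > 0" "difference_tail M l > 0" and R: "R \<ge> 0"
  shows "\<exists>C\<ge>0. \<forall>\<nu> n x. real_distribution \<nu> \<longrightarrow> (\<forall>t. char \<nu> t = char M t ^ n) \<longrightarrow> n > 0 \<longrightarrow>
    abs_tail M \<bar>x\<bar> > 0 \<longrightarrow>
    measure \<nu> {s. \<bar>s\<bar> \<le> \<bar>x\<bar> + R} \<le> C / sqrt (real n) * (1 / sqrt (abs_tail M \<bar>x\<bar>))"
proof -
  obtain m where m: "m > 0" "measure M {x. \<bar>x\<bar> \<le> m} \<ge> 1 / 2"
    using ex_median_bound by blast
  define K where "K = 2 * m + R"
  define C1 where "C1 = exp (((K + R) / l)\<^sup>2 / 2) * 10 / sqrt (difference_tail M l)"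
  define C2 :: real where "C2 = exp (4\<^sup>2 / 2) * 10 * sqrt 2"
  have C: "0 \<le> C1" "0 \<le> C2" using l by (auto simp: C1_def C2_def)
  show ?thesis
  proof (rule exI[of _ "C1 + C2"], intro conjI allI impI)
    show "0 \<le> C1 + C2" using C by simp
    fix \<nu> n x
    assume \<nu>: "real_distribution \<nu>" "\<forall>t. char \<nu> t = char M t ^ n" and n: "(n::nat) > 0"
      and q: "abs_tail M \<bar>x\<bar> > 0"
    interpret N: real_distribution \<nu> by fact
    define q where "q = abs_tail M \<bar>x\<bar>"
    have q01: "0 < q" "q \<le> 1" using q abs_tail_le_1 by (auto simp: q_def)
    show "measure \<nu> {s. \<bar>s\<bar> \<le> \<bar>x\<bar> + R} \<le> (C1 + C2) / sqrt (real n) * (1 / sqrt (abs_tail M \<bar>x\<bar>))"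
      unfolding q_def[symmetric]
    proof (cases "\<bar>x\<bar> \<le> K")
      case True
      have "measure \<nu> {s. \<bar>s\<bar> \<le> \<bar>x\<bar> + R} \<le> measure \<nu> {s. \<bar>s\<bar> \<le> (K + R) / l * l}"
        using True l by (intro N.finite_measure_mono) auto
      also have "\<dots> \<le> exp (((K + R) / l)\<^sup>2 / 2) * 10 / sqrt (real n * difference_tail M l)"
        using \<nu> n l by (intro measure_char_power_le[OF real_distribution_axioms]) auto
      also have "\<dots> = C1 / sqrt (real n) * 1"
        by (simp add: C1_def real_sqrt_mult)
      also have "\<dots> \<le> (C1 + C2) / sqrt (real n) * (1 / sqrt q)"
        using C q01 by (intro mult_mono divide_right_mono) auto
      finally show "measure \<nu> {s. \<bar>s\<bar> \<le> \<bar>x\<bar> + R} \<le> (C1 + C2) / sqrt (real n) * (1 / sqrt q)" .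
    next
      case False
      have sep: "difference_tail M (\<bar>x\<bar> - m) \<ge> q / 2"
        unfolding q_def by (rule difference_tail_ge_abs_tail[OF m(2)])
      \<comment> \<open>\<open>\<bar>x\<bar> > 2 m + R\<close> gives \<open>\<bar>x\<bar> + R \<le> 2 \<bar>x\<bar> \<le> 4 (\<bar>x\<bar> - m)\<close>.\<close>
      have "measure \<nu> {s. \<bar>s\<bar> \<le> \<bar>x\<bar> + R} \<le> measure \<nu> {s. \<bar>s\<bar> \<le> 4 * (\<bar>x\<bar> - m)}"
        using False m R by (intro N.finite_measure_mono) (auto simp: K_def)
      also have "\<dots> \<le> exp (4\<^sup>2 / 2) * 10 / sqrt (real n * difference_tail M (\<bar>x\<bar> - m))"
        using \<nu> n False m R sep q01 by (intro measure_char_power_le[OF real_distribution_axioms]) (auto simp: K_def)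
      also have "\<dots> \<le> exp (4\<^sup>2 / 2) * 10 / sqrt (real n * (q / 2))"
        using n sep q01 by (intro divide_left_mono real_sqrt_le_mono mult_left_mono mult_pos_pos) auto
      also have "\<dots> = C2 / sqrt (real n) * (1 / sqrt q)"
        by (simp add: C2_def real_sqrt_mult real_sqrt_divide)
      also have "\<dots> \<le> (C1 + C2) / sqrt (real n) * (1 / sqrt q)"
        using C q01 by (intro mult_right_mono divide_right_mono) auto
      finally show "measure \<nu> {s. \<bar>s\<bar> \<le> \<bar>x\<bar> + R} \<le> (C1 + C2) / sqrt (real n) * (1 / sqrt q)" .
    qed
  qed
qed

lemma AE_constant_if_difference_tail_zero:
  assumes "\<And>l. l > 0 \<Longrightarrow> difference_tail M l = 0"
  shows "\<exists>c. AE x in M. x = c"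
proof -
  interpret P: pair_prob_space M M ..
  have sets: "{(x, y). l \<le> \<bar>x - y\<bar>} \<in> sets (M \<Otimes>\<^sub>M M)" for l :: real
    by (rule sets_far_pairs) simp
  have "AE w in M \<Otimes>\<^sub>M M. w \<notin> {(x, y). 1 / real (Suc n) \<le> \<bar>x - y\<bar>}" for n
    using assms[of "1 / real (Suc n)"] sets[of "1 / real (Suc n)"]
    by (intro AE_not_in) (auto simp: difference_tail_def null_sets_def P.emeasure_eq_measure)
  then have "AE w in M \<Otimes>\<^sub>M M. \<forall>n. w \<notin> {(x, y). 1 / real (Suc n) \<le> \<bar>x - y\<bar>}"
    by (simp add: AE_all_countable)
  then have "AE w in M \<Otimes>\<^sub>M M. fst w = snd w"
  proof eventually_elim
    case (elim w)
    show ?case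
    proof (rule ccontr)
      assume "fst w \<noteq> snd w"
      then obtain n where "1 / real (Suc n) < \<bar>fst w - snd w\<bar>"
        using reals_Archimedean[of "\<bar>fst w - snd w\<bar>"] by (auto simp: inverse_eq_divide)
      with elim show False by (auto simp: case_prod_unfold dest!: spec[of _ n])
    qed
  qed
  from P.AE_pair[OF this] have "AE x in M. AE y in M. x = y" by simp
  then obtain x where "AE y in M. x = y"
    using AE_contr by (metis (no_types, lifting) eventually_mono)
  then show ?thesis by (auto intro!: exI[of _ x] elim: eventually_mono)
qed

end

section \<open>One-dimensional walks\<close>

text \<open>The event says that the segment from \<open>S\<^sub>n\<close> to \<open>S\<^sub>n + X\<^sub>n\<close> may reach \<open>[- R, R]\<close>. Conditioning on the
  independent step \<open>X\<^sub>n = x\<close> gives a bound of order \<open>1 / sqrt (n q(x))\<close> with \<open>q(x) = P(\<bar>X\<bar> \<ge> \<bar>x\<bar>)\<close>, which is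
  integrable in \<open>x\<close>, so large steps do no harm and no moment condition is needed.\<close>

lemma (in prob_space) ex_crossing_bound_nonconstant:
  fixes X :: "nat \<Rightarrow> 'a \<Rightarrow> real"
  assumes indep: "indep_vars (\<lambda>_. borel) X UNIV"
    and ident: "\<And>n. distr M borel (X n) = distr M borel (X 0)"
    and R: "R \<ge> 0" and l: "l > 0" "difference_tail (distr M borel (X 0)) l > 0"
  shows "\<exists>C\<ge>0. \<forall>n>0. prob {\<omega> \<in> space M. \<bar>\<Sum>j<n. X j \<omega>\<bar> \<le> \<bar>X n \<omega>\<bar> + R} \<le> C / sqrt (real n)"
proof -
  have [measurable]: "X n \<in> borel_measurable M" for n
    using indep by (auto simp: indep_vars_def)
  define \<mu> where "\<mu> = distr M borel (X 0)"
  interpret \<mu>: real_distribution \<mu>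
    unfolding \<mu>_def by (rule real_distribution_distr) simp
  obtain C where C: "C \<ge> 0" and bound: "\<And>\<nu> n x. real_distribution \<nu> \<Longrightarrow> (\<And>t. char \<nu> t = char \<mu> t ^ n) \<Longrightarrow> n > 0 \<Longrightarrow>
      abs_tail \<mu> \<bar>x\<bar> > 0 \<Longrightarrow>
      measure \<nu> {s. \<bar>s\<bar> \<le> \<bar>x\<bar> + R} \<le> C / sqrt (real n) * (1 / sqrt (abs_tail \<mu> \<bar>x\<bar>))"
    using \<mu>.ex_concentration_bound[OF l[folded \<mu>_def] R] by blast
  define I where "I = (\<integral>x. 1 / sqrt (abs_tail \<mu> \<bar>x\<bar>) \<partial>\<mu>)"
  have I: "I \<ge> 0" unfolding I_def by (intro integral_nonneg_AE) (auto simp: abs_tail_def)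
  show ?thesis
  proof (rule exI[of _ "C * I"], intro conjI allI impI)
    show "0 \<le> C * I" using C I by simp
    fix n :: nat assume n: "n > 0"
    define S where "S \<omega> = (\<Sum>j<n. X j \<omega>)" for \<omega>
    have [measurable]: "S \<in> borel_measurable M" unfolding S_def by measurable
    define \<nu> where "\<nu> = distr M borel S"
    interpret \<nu>: real_distribution \<nu>
      unfolding \<nu>_def by (rule real_distribution_distr) simp
    have char: "char \<nu> t = char \<mu> t ^ n" for t
    proof -
      have ident_char: "char (distr M borel (X j)) t = char \<mu> t" for j
        using ident[of j] by (simp only: \<mu>_def)
      have "char \<nu> t = (\<Prod>j<n. char (distr M borel (X j)) t)"
        unfolding \<nu>_def S_def using indep by (intro char_distr_sum indep_vars_subset[OF indep]) auto
      also have "\<dots> = char \<mu> t ^ n" by (simp add: ident_char)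
      finally show ?thesis .
    qed
    have "indep_var borel (X n) borel S"
      unfolding S_def by (rule indep_vars_sum) (auto intro: indep_vars_subset[OF indep])
    then have joint: "distr M (borel \<Otimes>\<^sub>M borel) (\<lambda>\<omega>. (X n \<omega>, S \<omega>)) = \<mu> \<Otimes>\<^sub>M \<nu>"
      unfolding indep_var_distribution_eq \<mu>_def \<nu>_def using ident[of n] by simp
    define E where "E = {w \<in> space (borel \<Otimes>\<^sub>M borel). \<bar>snd w\<bar> \<le> \<bar>fst w\<bar> + (R::real)}"
    have E: "E \<in> sets (borel \<Otimes>\<^sub>M borel)" unfolding E_def by measurable
    have "ennreal (prob {\<omega> \<in> space M. \<bar>S \<omega>\<bar> \<le> \<bar>X n \<omega>\<bar> + R}) = emeasure (\<mu> \<Otimes>\<^sub>M \<nu>) E"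
      unfolding joint[symmetric] using E
      by (subst emeasure_distr)
         (auto simp: emeasure_eq_measure E_def space_pair_measure intro!: arg_cong[where f=prob])
    also have "\<dots> = (\<integral>\<^sup>+x. emeasure \<nu> (Pair x -` E) \<partial>\<mu>)"
      using E by (intro \<nu>.emeasure_pair_measure_alt) (simp cong: sets_pair_measure_cong)
    also have "\<dots> = (\<integral>\<^sup>+x. ennreal (measure \<nu> {s. \<bar>s\<bar> \<le> \<bar>x\<bar> + R}) \<partial>\<mu>)"
      by (simp add: \<nu>.emeasure_eq_measure E_def space_pair_measure vimage_def)
    also have "\<dots> \<le> (\<integral>\<^sup>+x. ennreal (C / sqrt (real n) * (1 / sqrt (abs_tail \<mu> \<bar>x\<bar>))) \<partial>\<mu>)"
    proof (rule nn_integral_mono_AE)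
      show "AE x in \<mu>. ennreal (measure \<nu> {s. \<bar>s\<bar> \<le> \<bar>x\<bar> + R}) \<le>
          ennreal (C / sqrt (real n) * (1 / sqrt (abs_tail \<mu> \<bar>x\<bar>)))"
        using \<mu>.AE_abs_tail_pos
        by eventually_elim (intro ennreal_leI bound \<nu>.real_distribution_axioms char n)
    qed
    also have "\<dots> = ennreal (\<integral>x. C / sqrt (real n) * (1 / sqrt (abs_tail \<mu> \<bar>x\<bar>)) \<partial>\<mu>)"
      using C by (intro nn_integral_eq_integral integrable_mult_right \<mu>.integrable_inverse_sqrt_abs_tail)
        (auto simp: abs_tail_def)
    also have "(\<integral>x. C / sqrt (real n) * (1 / sqrt (abs_tail \<mu> \<bar>x\<bar>)) \<partial>\<mu>) = C / sqrt (real n) * I"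
      unfolding I_def by (rule integral_mult_right_zero)
    finally have "prob {\<omega> \<in> space M. \<bar>S \<omega>\<bar> \<le> \<bar>X n \<omega>\<bar> + R} \<le> C / sqrt (real n) * I"
      using C I by (subst (asm) ennreal_le_iff) auto
    then show "prob {\<omega> \<in> space M. \<bar>\<Sum>j<n. X j \<omega>\<bar> \<le> \<bar>X n \<omega>\<bar> + R} \<le> C * I / sqrt (real n)"
      by (simp add: S_def)
  qed
qed

text \<open>A walk with constant nonzero step \<open>c\<close> has only finitely many such times, so the same bound holds
  for every step law other than the point mass at 0.\<close>

lemma (in prob_space) ex_crossing_bound:
  fixes X :: "nat \<Rightarrow> 'a \<Rightarrow> real"
  assumes indep: "indep_vars (\<lambda>_. borel) X UNIV"
    and ident: "\<And>n. distr M borel (X n) = distr M borel (X 0)"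
    and R: "R \<ge> 0" and nz: "\<not> (AE x in distr M borel (X 0). x = 0)"
  shows "\<exists>C\<ge>0. \<forall>n>0. prob {\<omega> \<in> space M. \<bar>\<Sum>j<n. X j \<omega>\<bar> \<le> \<bar>X n \<omega>\<bar> + R} \<le> C / sqrt (real n)"
proof (cases "\<exists>l>0. difference_tail (distr M borel (X 0)) l > 0")
  case True
  then obtain l where "l > 0" "difference_tail (distr M borel (X 0)) l > 0" by blast
  then show ?thesis by (rule ex_crossing_bound_nonconstant[OF indep ident R])
next
  case False
  have [measurable]: "X n \<in> borel_measurable M" for n
    using indep by (auto simp: indep_vars_def)
  interpret \<mu>: real_distribution "distr M borel (X 0)"
    by (rule real_distribution_distr) simp
  have "difference_tail (distr M borel (X 0)) l = 0" if "l > 0" for l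
  proof -
    have "\<not> difference_tail (distr M borel (X 0)) l > 0" using False that by blast
    moreover have "difference_tail (distr M borel (X 0)) l \<ge> 0" by (simp add: difference_tail_def)
    ultimately show ?thesis by linarith
  qed
  then obtain c where c: "AE x in distr M borel (X 0). x = c"
    using \<mu>.AE_constant_if_difference_tail_zero by blast
  have "c \<noteq> 0" using c nz by auto
  have "AE \<omega> in M. X n \<omega> = c" for n
  proof -
    have "AE x in distr M borel (X n). x = c" using c by (simp only: ident[of n])
    then show ?thesis by (subst (asm) AE_distr_iff) auto
  qed
  then have const: "AE \<omega> in M. \<forall>n. X n \<omega> = c" by (simp add: AE_all_countable)
  obtain N where N: "(\<bar>c\<bar> + R) / \<bar>c\<bar> < real N" using reals_Archimedean2 by blast
  show ?thesis
  proof (rule exI[of _ "sqrt (real N)"], intro conjI allI impI)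
    fix n :: nat assume n: "n > 0"
    show "prob {\<omega> \<in> space M. \<bar>\<Sum>j<n. X j \<omega>\<bar> \<le> \<bar>X n \<omega>\<bar> + R} \<le> sqrt (real N) / sqrt (real n)"
    proof (cases "n \<le> N")
      case True
      have "prob {\<omega> \<in> space M. \<bar>\<Sum>j<n. X j \<omega>\<bar> \<le> \<bar>X n \<omega>\<bar> + R} \<le> 1" by simp
      also have "1 \<le> sqrt (real N) / sqrt (real n)" using True n by simp
      finally show ?thesis .
    next
      case False
      have "\<bar>c\<bar> + R < real n * \<bar>c\<bar>"
      proof -
        have "\<bar>c\<bar> + R < real N * \<bar>c\<bar>" using N \<open>c \<noteq> 0\<close> by (simp add: field_simps)
        also have "\<dots> \<le> real n * \<bar>c\<bar>" using False by (intro mult_right_mono) auto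
        finally show ?thesis .
      qed
      then have "AE \<omega> in M. \<omega> \<notin> {\<omega> \<in> space M. \<bar>\<Sum>j<n. X j \<omega>\<bar> \<le> \<bar>X n \<omega>\<bar> + R}"
        using const by (auto elim!: eventually_mono simp: abs_mult)
      then have "prob {\<omega> \<in> space M. \<bar>\<Sum>j<n. X j \<omega>\<bar> \<le> \<bar>X n \<omega>\<bar> + R} = 0"
        by (subst prob_eq_0) auto
      then show ?thesis by simp
    qed
  qed simp
qed

section \<open>Polygonal transience\<close>

text \<open>If \<open>p\<close> is at parameter \<open>u\<close> of the segment from \<open>a\<close> to \<open>b\<close>, then \<open>a = p - u (b - a)\<close>.\<close>

lemma segment_coord_le:
  fixes a b p :: "real ^ 'd"
  assumes "p \<in> closed_segment a b" "\<bar>p $ i\<bar> \<le> R"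
  shows "\<bar>a $ i\<bar> \<le> \<bar>b $ i - a $ i\<bar> + R"
proof -
  obtain u where u: "0 \<le> u" "u \<le> 1" and p: "p = (1 - u) *\<^sub>R a + u *\<^sub>R b"
    using assms(1) by (auto simp: in_segment)
  define z where "z = u * (b $ i - a $ i)"
  have "a $ i = p $ i - z"
    by (simp add: p z_def algebra_simps)
  moreover have "\<bar>z\<bar> \<le> \<bar>b $ i - a $ i\<bar>"
    unfolding z_def abs_mult using u by (intro mult_left_le_one_le) auto
  ultimately show ?thesis using assms(2) by linarith
qed

text \<open>The event for coordinate \<open>i\<close> depends on the \<open>i\<close>-th coordinate process only, through its values at
  the times \<open>n\<close> and \<open>n + 1\<close>.\<close>

lemma (in prob_space) prob_all_coords_eq_prod:
  fixes S :: "nat \<Rightarrow> 'a \<Rightarrow> real ^ 'd"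
  assumes "independent_components M S"
  shows "prob {\<omega> \<in> space M. \<forall>i. \<bar>S n \<omega> $ i\<bar> \<le> \<bar>S (Suc n) \<omega> $ i - S n \<omega> $ i\<bar> + R} =
    (\<Prod>i\<in>UNIV. prob {\<omega> \<in> space M. \<bar>S n \<omega> $ i\<bar> \<le> \<bar>S (Suc n) \<omega> $ i - S n \<omega> $ i\<bar> + R})"
proof -
  define A where "A = {f \<in> space (Pi\<^sub>M UNIV (\<lambda>_. borel)). \<bar>f n\<bar> \<le> \<bar>f (Suc n) - f n\<bar> + R}"
  have A: "A \<in> sets (Pi\<^sub>M UNIV (\<lambda>_::nat. borel))"
    unfolding A_def by measurable
  have "prob (\<Inter>i\<in>UNIV. (\<lambda>\<omega> n. S n \<omega> $ i) -` A \<inter> space M) =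
      (\<Prod>i\<in>UNIV. prob ((\<lambda>\<omega> n. S n \<omega> $ i) -` A \<inter> space M))"
    using assms A unfolding independent_components_def by (intro indep_varsD_finite) auto
  also have "(\<Inter>i\<in>UNIV. (\<lambda>\<omega> n. S n \<omega> $ i) -` A \<inter> space M) =
      {\<omega> \<in> space M. \<forall>i. \<bar>S n \<omega> $ i\<bar> \<le> \<bar>S (Suc n) \<omega> $ i - S n \<omega> $ i\<bar> + R}"
    by (auto simp: A_def space_PiM)
  also have "(\<lambda>i. (\<lambda>\<omega> n. S n \<omega> $ i) -` A \<inter> space M) =
      (\<lambda>i. {\<omega> \<in> space M. \<bar>S n \<omega> $ i\<bar> \<le> \<bar>S (Suc n) \<omega> $ i - S n \<omega> $ i\<bar> + R})"
    by (auto simp: A_def space_PiM fun_eq_iff)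
  finally show ?thesis .
qed

lemma measurable_vec_nth [measurable (raw)]:
  fixes f :: "'a \<Rightarrow> real ^ 'd"
  assumes "f \<in> borel_measurable M"
  shows "(\<lambda>x. f x $ i) \<in> borel_measurable M"
  using assms by (rule measurable_compose) (intro borel_measurable_continuous_onI continuous_intros)

lemma component_law_nonzero:
  fixes X :: "'a \<Rightarrow> real ^ 'd"
  assumes "truly_full_dimensional (distr M borel X)" and [measurable]: "X \<in> borel_measurable M"
  shows "\<not> (AE x in distr M borel (\<lambda>\<omega>. X \<omega> $ i). x = 0)"
proof
  assume "AE x in distr M borel (\<lambda>\<omega>. X \<omega> $ i). x = 0"
  then have "AE \<omega> in M. X \<omega> $ i = 0" by (subst (asm) AE_distr_iff) auto
  then have "AE x in distr M borel X. x \<in> {x. x $ i = 0}"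
    by (subst AE_distr_iff) auto
  moreover have "subspace {x :: real ^ 'd. x $ i = 0}"
    by (auto simp: subspace_def)
  moreover have "{x :: real ^ 'd. x $ i = 0} \<noteq> UNIV"
  proof
    assume *: "{x :: real ^ 'd. x $ i = 0} = UNIV"
    have "axis i 1 \<in> {x :: real ^ 'd. x $ i = 0}" unfolding * by simp
    then show False by (simp add: axis_def)
  qed
  ultimately show False using assms(1) by (auto simp: truly_full_dimensional_def)
qed

theorem theorem1:
  fixes M :: "'a measure" and X :: "nat \<Rightarrow> 'a \<Rightarrow> real ^ 3"
  assumes "prob_space M"
    and "iid_steps M X"
    and "truly_full_dimensional (distr M borel (X 0))"
    and "independent_components M (walk X)"
  shows "polygonally_transient M (walk X)"
  unfolding polygonally_transient_def
proof
  interpret prob_space M by fact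
  have indep: "indep_vars (\<lambda>_. borel) X UNIV"
    and ident: "distr M borel (X n) = distr M borel (X 0)" for n
    using assms(2) by (auto simp: iid_steps_def)
  have [measurable]: "X n \<in> borel_measurable M" for n
    using indep by (auto simp: indep_vars_def)
  have walk_meas[measurable]: "walk X n \<in> borel_measurable M" for n
    unfolding walk_def[abs_def] by measurable
  assume "polygonally_recurrent M (walk X)"
  then obtain B where B: "bounded B"
    and rec: "AE \<omega> in M. \<exists>\<^sub>\<infinity>n. closed_segment (walk X n \<omega>) (walk X (Suc n) \<omega>) \<inter> B \<noteq> {}"
    by (auto simp: polygonally_recurrent_def)
  obtain R where R: "R \<ge> 0" "\<And>p. p \<in> B \<Longrightarrow> norm p \<le> R"
    using B by (auto simp: bounded_pos intro: less_imp_le)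
  \<comment> \<open>\<open>H n i\<close>: the \<open>i\<close>-th coordinate of the \<open>n\<close>-th segment may reach \<open>[- R, R]\<close>.\<close>
  define H where "H n i = {\<omega> \<in> space M. \<bar>walk X n \<omega> $ i\<bar> \<le> \<bar>walk X (Suc n) \<omega> $ i - walk X n \<omega> $ i\<bar> + R}" for n i
  define E where "E n = (\<Inter>i. H n i)" for n
  have [measurable]: "H n i \<in> sets M" for n i unfolding H_def by measurable
  have E_sets: "E n \<in> sets M" for n unfolding E_def by (intro sets.finite_INT) auto
  have "\<exists>C\<ge>0. \<forall>n>0. prob (H n i) \<le> C / sqrt (real n)" for i
  proof -
    have "indep_vars (\<lambda>_. borel) (\<lambda>n \<omega>. X n \<omega> $ i) UNIV"
      by (rule indep_vars_compose2[OF indep]) simp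
    moreover have "distr M borel (\<lambda>\<omega>. X n \<omega> $ i) = distr M borel (\<lambda>\<omega>. X 0 \<omega> $ i)" for n
    proof -
      have "distr M borel (\<lambda>\<omega>. X n \<omega> $ i) = distr (distr M borel (X n)) borel (\<lambda>x. x $ i)" for n
        by (subst distr_distr) (auto simp: comp_def)
      then show ?thesis by (simp only: ident[of n])
    qed
    ultimately have "\<exists>C\<ge>0. \<forall>n>0. prob {\<omega> \<in> space M. \<bar>\<Sum>j<n. X j \<omega> $ i\<bar> \<le> \<bar>X n \<omega> $ i\<bar> + R} \<le> C / sqrt (real n)"
      by (rule ex_crossing_bound[where X="\<lambda>n \<omega>. X n \<omega> $ i", OF _ _ R(1) component_law_nonzero[OF assms(3)]]) simp
    then show ?thesis by (simp add: H_def walk_def)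
  qed
  then have "\<forall>i. \<exists>C. C \<ge> 0 \<and> (\<forall>n>0. prob (H n i) \<le> C / sqrt (real n))" by blast
  then obtain C where "\<forall>i. C i \<ge> 0 \<and> (\<forall>n>0. prob (H n i) \<le> C i / sqrt (real n))"
    by (rule choice[THEN exE])
  then have C: "\<And>i. C i \<ge> 0" "\<And>n i. n > 0 \<Longrightarrow> prob (H n i) \<le> C i / sqrt (real n)"
    by blast+
  have prob_E: "prob (E n) \<le> (\<Prod>i\<in>UNIV. C i) * real n powr (- (3 / 2))" if n: "n > 0" for n
  proof -
    have "E n = {\<omega> \<in> space M. \<forall>i. \<bar>walk X n \<omega> $ i\<bar> \<le> \<bar>walk X (Suc n) \<omega> $ i - walk X n \<omega> $ i\<bar> + R}"
      by (auto simp: E_def H_def)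
    then have "prob (E n) = (\<Prod>i\<in>UNIV. prob (H n i))"
      using prob_all_coords_eq_prod[OF assms(4), of n R] by (simp only: H_def)
    also have "\<dots> \<le> (\<Prod>i\<in>UNIV. C i / sqrt (real n))"
      by (intro prod_mono) (auto intro: C n)
    also have "\<dots> = (\<Prod>i\<in>UNIV. C i) / sqrt (real n) ^ 3"
      by (simp add: prod_dividef)
    also have "sqrt (real n) ^ 3 = real n powr (3 / 2)"
      using n by (simp add: powr_half_sqrt[symmetric] powr_power)
    finally show ?thesis by (simp only: powr_minus divide_inverse)
  qed
  have "summable (\<lambda>n. prob (E n))"
  proof (rule summable_comparison_test_ev)
    show "\<forall>\<^sub>F n in sequentially. norm (prob (E n)) \<le> (\<Prod>i\<in>UNIV. C i) * real n powr (- (3 / 2))"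
      using eventually_gt_at_top[of 0] by eventually_elim (simp add: prob_E)
    show "summable (\<lambda>n. (\<Prod>i\<in>UNIV. C i) * real n powr (- (3 / 2)))"
      by (intro summable_mult) (simp add: summable_real_powr_iff)
  qed
  then have "AE \<omega> in M. eventually (\<lambda>n. \<omega> \<in> space M - E n) sequentially"
    by (intro borel_cantelli_AE1 E_sets) (auto simp: less_top[symmetric])
  with rec AE_space have "AE \<omega> in M. False"
  proof eventually_elim
    case (elim \<omega>)
    have "\<omega> \<in> E n" if "closed_segment (walk X n \<omega>) (walk X (Suc n) \<omega>) \<inter> B \<noteq> {}" for n
    proof -
      obtain p where p: "p \<in> closed_segment (walk X n \<omega>) (walk X (Suc n) \<omega>)" "p \<in> B"
        using \<open>closed_segment _ _ \<inter> B \<noteq> {}\<close> by blast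
      have "\<bar>p $ i\<bar> \<le> R" for i
        using R(2)[OF p(2)] component_le_norm_cart[of p i] by linarith
      then show ?thesis
        using segment_coord_le[OF p(1)] elim by (auto simp: E_def H_def)
    qed
    moreover obtain N where "\<And>n. n \<ge> N \<Longrightarrow> \<omega> \<notin> E n"
      using elim by (auto simp: eventually_sequentially)
    moreover have "\<exists>n\<ge>N. closed_segment (walk X n \<omega>) (walk X (Suc n) \<omega>) \<inter> B \<noteq> {}"
      using elim unfolding INFM_nat_le by blast
    ultimately show False by blast
  qed
  then show False by simp
qed

end
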